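(* Let $\langle T,<\rangle$ be an everywhere infinitely branching tree and let $F$ be an ultrafiltration on $T$ such that $F(t)$ is countably complete for each $t\in T$. Then the space $X(F)$ is $\omega$-resolvable but hereditarily $\omega_1$-irresolvable. In particular, if $\kappa$ is a measurable cardinal then there is a monotonically normal space $X$ with $|X|=\Delta(X)=\kappa$ that is hereditarily $\omega_1$-irresolvable.
   Context: A space is $\kappa$-resolvable if it contains $\kappa$ many pairwise disjoint dense subsets, and $\kappa$-irresolvable otherwise; it is hereditarily $\kappa$-irresolvable if no nonempty subspace of it is $\kappa$-resolvable. $\Delta(X)=\min\{|G|: G\neq\emptyset\text{ open in }X\}$ is the dispersion character of $X$. A tree is a (nonempty) partially ordered set in which the set of predecessors of each element is well-ordered. A tree $\langle T,<\rangle$ is everywhere infinitely branching if for each $t\in T$ the set $S_t$ of all immediate successors of $t$ is infinite. A filtration on $T$ is a map $F$ assigning to each $t\in T$ a filter $F(t)$ on $S_t$ containing every cofinite subset of $S_t$; it is an ultrafiltration if each $F(t)$ is an ultrafilter (necessarily free). $X(F)$ is the space $\langle T,\tau_F\rangle$, where $\tau_F=\{V\subseteq T:\forall t\in V\ (V\cap S_t\in F(t))\}$. For a topological space $X$ with topology $\tau(X)$, let $\mathcal{M}(X)=\{\langle x,U\rangle\in X\times\tau(X): x\in U\}$. The space $X$ is monotonically normal if it is $T_1$ and there is a function $H:\mathcal{M}(X)\to\tau(X)$ such that (1) $x\in H(x,U)\subseteq U$ for each $\langle x,U\rangle\in\mathcal{M}(X)$; (2) if $H(x,U)\cap H(y,V)\neq\emptyset$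 then $x\in V$ or $y\in U$. *)

theory Defs
  imports "HOL-Analysis.Analysis"
begin

unbundle cardinal_syntax

text \<open>
  Cardinals are cardinal well-orders in the sense of the BNF cardinal library:
  \<^term>\<open>natLeq\<close> is $\omega$ and \<^term>\<open>cardSuc natLeq\<close> is $\omega_1$. A family of $\kappa$ many
  objects is a set that is equipotent to $\kappa$.
\<close>

abbreviation omega1 :: "nat set rel" where
  "omega1 \<equiv> cardSuc natLeq"

definition dense_subset :: "'a topology \<Rightarrow> 'a set \<Rightarrow> bool" where
  "dense_subset X D \<longleftrightarrow> D \<subseteq> topspace X \<and> X closure_of D = topspace X"

definition resolvable :: "'k rel \<Rightarrow> 'a topology \<Rightarrow> bool" where
  "resolvable \<kappa> X \<longleftrightarrow>
     (\<exists>\<D>. |\<D>| =o \<kappa> \<and> pairwise disjnt \<D> \<and> (\<forall>D\<in>\<D>. dense_subset X D))"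

abbreviation irresolvable :: "'k rel \<Rightarrow> 'a topology \<Rightarrow> bool" where
  "irresolvable \<kappa> X \<equiv> \<not> resolvable \<kappa> X"

definition hereditarily_irresolvable :: "'k rel \<Rightarrow> 'a topology \<Rightarrow> bool" where
  "hereditarily_irresolvable \<kappa> X \<longleftrightarrow>
     (\<forall>Y. Y \<subseteq> topspace X \<and> Y \<noteq> {} \<longrightarrow> irresolvable \<kappa> (subtopology X Y))"

text \<open>
  The minimum exists whenever \<^term>\<open>X\<close> is nonempty, because \<open>\<le>o\<close> is well-founded; it is
  unique up to \<open>=o\<close>.
\<close>

definition dispersion_character :: "'a topology \<Rightarrow> 'a rel" where
  "dispersion_character X =
     (SOME r. \<exists>G. openin X G \<and> G \<noteq> {} \<and> r = |G| \<and>
                  (\<forall>G'. openin X G' \<and> G' \<noteq> {} \<longrightarrow> |G| \<le>o |G'| ))"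

definition monotonically_normal :: "'a topology \<Rightarrow> bool" where
  "monotonically_normal X \<longleftrightarrow>
     t1_space X \<and>
     (\<exists>H. (\<forall>x U. openin X U \<and> x \<in> U \<longrightarrow> openin X (H x U) \<and> x \<in> H x U \<and> H x U \<subseteq> U) \<and>
          (\<forall>x U y V. openin X U \<and> x \<in> U \<and> openin X V \<and> y \<in> V \<and> H x U \<inter> H y V \<noteq> {}
                     \<longrightarrow> x \<in> V \<or> y \<in> U))"

text \<open>
  A tree $\langle T,<\rangle$ is given by its carrier \<open>T\<close> and the reflexive order \<open>R\<close>
  belonging to $<$. Trees need neither be rooted nor have height at most $\omega$.
\<close>

definition tree :: "'a set \<Rightarrow> 'a rel \<Rightarrow> bool" where
  "tree T R \<longleftrightarrow>
     T \<noteq> {} \<and> partial_order_on T R \<and>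
     (\<forall>t\<in>T. well_order_on (underS R t) (Restr R (underS R t)))"

definition immediate_successors :: "'a rel \<Rightarrow> 'a \<Rightarrow> 'a set" where
  "immediate_successors R t = {s. t \<in> underS R s \<and> (\<nexists>u. t \<in> underS R u \<and> u \<in> underS R s)}"

definition everywhere_infinitely_branching :: "'a set \<Rightarrow> 'a rel \<Rightarrow> bool" where
  "everywhere_infinitely_branching T R \<longleftrightarrow> (\<forall>t\<in>T. infinite (immediate_successors R t))"

text \<open>
  A filter on a set \<open>S\<close> is encoded as a filter on the ambient type that contains \<open>S\<close>;
  a subset \<open>A\<close> of \<open>S\<close> belongs to it iff \<^term>\<open>eventually (\<lambda>x. x \<in> A) \<F>\<close>.
  Filters on a set are proper.
\<close>

definition filter_on :: "'a set \<Rightarrow> 'a filter \<Rightarrow> bool" where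
  "filter_on S \<F> \<longleftrightarrow> \<F> \<le> principal S \<and> \<F> \<noteq> bot"

definition ultrafilter_on :: "'a set \<Rightarrow> 'a filter \<Rightarrow> bool" where
  "ultrafilter_on S \<F> \<longleftrightarrow>
     filter_on S \<F> \<and>
     (\<forall>A\<subseteq>S. eventually (\<lambda>x. x \<in> A) \<F> \<or> eventually (\<lambda>x. x \<in> S - A) \<F>)"

definition countably_complete :: "'a filter \<Rightarrow> bool" where
  "countably_complete \<F> \<longleftrightarrow>
     (\<forall>A :: nat \<Rightarrow> 'a set. (\<forall>n. eventually (\<lambda>x. x \<in> A n) \<F>) \<longrightarrow> eventually (\<lambda>x. x \<in> (\<Inter>n. A n)) \<F>)"

definition complete_filter :: "'k rel \<Rightarrow> 'a filter \<Rightarrow> bool" where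
  "complete_filter \<kappa> \<F> \<longleftrightarrow>
     (\<forall>\<A>. |\<A>| <o \<kappa> \<and> (\<forall>A\<in>\<A>. eventually (\<lambda>x. x \<in> A) \<F>) \<longrightarrow> eventually (\<lambda>x. x \<in> \<Inter>\<A>) \<F>)"

text \<open>
  An uncountable cardinal carrying a $\kappa$-complete nonprincipal ultrafilter.
\<close>

definition measurable_cardinal :: "'k rel \<Rightarrow> bool" where
  "measurable_cardinal \<kappa> \<longleftrightarrow>
     Card_order \<kappa> \<and> natLeq <o \<kappa> \<and>
     (\<exists>\<U>. ultrafilter_on (Field \<kappa>) \<U> \<and>
          (\<forall>a\<in>Field \<kappa>. \<not> eventually (\<lambda>x. x \<in> {a}) \<U>) \<and>
          complete_filter \<kappa> \<U>)"

definition filtration :: "'a set \<Rightarrow> 'a rel \<Rightarrow> ('a \<Rightarrow> 'a filter) \<Rightarrow> bool" where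
  "filtration T R F \<longleftrightarrow>
     (\<forall>t\<in>T. filter_on (immediate_successors R t) (F t) \<and>
        (\<forall>A\<subseteq>immediate_successors R t.
           finite (immediate_successors R t - A) \<longrightarrow> eventually (\<lambda>s. s \<in> A) (F t)))"

definition ultrafiltration :: "'a set \<Rightarrow> 'a rel \<Rightarrow> ('a \<Rightarrow> 'a filter) \<Rightarrow> bool" where
  "ultrafiltration T R F \<longleftrightarrow>
     filtration T R F \<and> (\<forall>t\<in>T. ultrafilter_on (immediate_successors R t) (F t))"

definition filtration_space :: "'a set \<Rightarrow> 'a rel \<Rightarrow> ('a \<Rightarrow> 'a filter) \<Rightarrow> 'a topology" where
  "filtration_space T R F =
     topology (\<lambda>V. V \<subseteq> T \<and> (\<forall>t\<in>V. eventually (\<lambda>s. s \<in> V \<inter> immediate_successors R t) (F t)))"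

lemma openin_filtration_space:
  "openin (filtration_space T R F) V \<longleftrightarrow>
     V \<subseteq> T \<and> (\<forall>t\<in>V. eventually (\<lambda>s. s \<in> V \<inter> immediate_successors R t) (F t))"
proof -
  let ?S = "immediate_successors R"
  have "istopology (\<lambda>V. V \<subseteq> T \<and> (\<forall>t\<in>V. eventually (\<lambda>s. s \<in> V \<inter> ?S t) (F t)))"
    unfolding istopology_def
  proof (intro conjI allI impI ballI, goal_cases)
    case (2 U V t)
    then have "eventually (\<lambda>s. s \<in> U \<inter> ?S t) (F t)" "eventually (\<lambda>s. s \<in> V \<inter> ?S t) (F t)"
      by auto
    then show ?case
      by eventually_elim auto
  next
    case (4 \<K> t)
    then obtain K where "K \<in> \<K>" "t \<in> K" by auto
    with 4 have "eventually (\<lambda>s. s \<in> K \<inter> ?S t) (F t)" by auto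
    then show ?case
      by eventually_elim (use \<open>K \<in> \<K>\<close> in auto)
  qed auto
  then show ?thesis
    by (simp add: filtration_space_def)
qed

lemma topspace_filtration_space:
  assumes "partial_order_on T R" "filtration T R F"
  shows "topspace (filtration_space T R F) = T"
proof -
  have "openin (filtration_space T R F) T"
    unfolding openin_filtration_space
  proof (intro conjI ballI)
    fix t assume "t \<in> T"
    then have "eventually (\<lambda>s. s \<in> immediate_successors R t) (F t)"
      using assms(2) by (auto simp: filtration_def filter_on_def le_principal)
    then show "eventually (\<lambda>s. s \<in> T \<inter> immediate_successors R t) (F t)"
      by eventually_elim
        (use partial_order_onD(4)[OF assms(1)] in
          \<open>auto simp: immediate_successors_def underS_def\<close>)
  qed simp
  moreover have "V \<subseteq> T" if "openin (filtration_space T R F) V" for V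
    using that by (simp add: openin_filtration_space)
  ultimately show ?thesis
    by (meson openin_subset openin_topspace subset_antisym)
qed

end

theory Submission
  imports Defs "HOL-Library.Sublist"
begin

text \<open>
  A nonempty open set meets all levels above any of its points, so a partition of $\omega$ into
  infinitely many infinite sets of levels gives $\omega$ many disjoint dense sets. Conversely, given
  $D$, let $D_0 = D$ and $D_{n+1} = \{t : D_n \in F(t)\}$. By countable completeness the complement
  of $\bigcup_n D_n$ is open, so every point $t$ in the closure of $D$ lies in some $D_n$; and if
  $D, E$ are disjoint then so are $D_n, E_n$, since filters are proper. Thus the members of a disjoint
  family of sets that are dense in a subspace containing $t$ are told apart by the number $n$, and the
  family is countable. For the second part, take the tree of finite sequences in a measurable cardinal,
  with a copy of the measure at every node; for monotone normality let $H(x,U)$ be the set of points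
  that are reached from $x$ by successor steps inside $U$.
\<close>

section \<open>Immediate successors and well-foundedness in trees\<close>

definition successor_rel :: "'a rel \<Rightarrow> 'a rel" where
  "successor_rel R = {(t, s). s \<in> immediate_successors R t}"

lemma in_successor_rel [simp]: "(t, s) \<in> successor_rel R \<longleftrightarrow> s \<in> immediate_successors R t"
  by (simp add: successor_rel_def)

lemma successor_relD:
  assumes "s \<in> immediate_successors R t"
  shows "(t, s) \<in> R" "t \<noteq> s"
  using assms by (auto simp: immediate_successors_def underS_def)

lemma immediate_successors_in_tree:
  assumes "tree T R" "s \<in> immediate_successors R t"
  shows "t \<in> T" "s \<in> T"
  using successor_relD(1)[OF assms(2)] assms(1) partial_order_onD(4)[of T R]
  by (auto simp: tree_def)

text \<open>The predecessors of \<open>s\<close> are linearly ordered, so of two distinct immediate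
  predecessors the larger one would lie strictly between the smaller one and
  \<open>s\<close>.\<close>

lemma immediate_predecessor_unique:
  assumes "tree T R" "s \<in> immediate_successors R t" "s \<in> immediate_successors R t'"
  shows "t = t'"
proof (rule ccontr)
  assume "t \<noteq> t'"
  have "s \<in> T"
    using assms immediate_successors_in_tree by fast
  then have "well_order_on (underS R s) (Restr R (underS R s))"
    using assms(1) by (simp add: tree_def)
  then have "total_on (underS R s) (Restr R (underS R s))"
    by (simp add: well_order_on_def linear_order_on_def)
  moreover have "t \<in> underS R s" "t' \<in> underS R s"
    using assms(2,3) by (auto simp: immediate_successors_def)
  ultimately have "(t, t') \<in> R \<or> (t', t) \<in> R"
    using \<open>t \<noteq> t'\<close> by (auto simp: total_on_def)
  then show False
    using assms(2,3) \<open>t \<noteq> t'\<close> by (auto simp: immediate_successors_def underS_def)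
qed

text \<open>If a point \<open>x\<close> of \<open>Q\<close> is not itself minimal, then
  \<open>Q\<close> meets the well-ordered set of predecessors of \<open>x\<close>. A least element
  there is minimal in all of \<open>Q\<close>, because by transitivity everything below it is again
  a predecessor of \<open>x\<close>.\<close>

lemma wf_tree:
  assumes "tree T R"
  shows "wf (R - Id)"
  unfolding wf_eq_minimal
proof (intro allI impI)
  fix Q and x :: 'a
  assume "x \<in> Q"
  show "\<exists>z\<in>Q. \<forall>y. (y, z) \<in> R - Id \<longrightarrow> y \<notin> Q"
  proof (cases "Q \<inter> underS R x = {}")
    case True
    with \<open>x \<in> Q\<close> show ?thesis
      by (auto simp: underS_def)
  next
    case False
    have "R \<subseteq> T \<times> T" and tr: "trans R" and asym: "antisym R"
      using assms partial_order_onD[of T R] by (auto simp: tree_def)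
    with False have "x \<in> T"
      by (auto simp: underS_def)
    then have "wf (Restr R (underS R x) - Id)"
      using assms by (auto simp: tree_def well_order_on_def)
    then obtain z where z: "z \<in> Q" "z \<in> underS R x"
      and min: "\<And>y. (y, z) \<in> Restr R (underS R x) - Id \<Longrightarrow> y \<notin> Q \<inter> underS R x"
      using False unfolding wf_eq_minimal by (metis IntD1 IntD2 ex_in_conv)
    have "y \<notin> Q" if "(y, z) \<in> R - Id" for y
    proof -
      have "y \<in> underS R x"
        using that z tr asym by (auto simp: underS_def dest: transD antisymD)
      then show ?thesis
        using min[of y] that z by auto
    qed
    with z show ?thesis
      by blast
  qed
qed

lemma wf_successor_rel:
  assumes "tree T R"
  shows "wf (successor_rel R)"
  by (rule wf_subset[OF wf_tree[OF assms]]) (auto dest: successor_relD)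

section \<open>Levels of a tree and countable resolvability\<close>

text \<open>
  Levels are counted from the nearest node below that has no immediate predecessor, so that every
  node of an arbitrarily high tree is on a finite level.
\<close>

primrec level :: "'a set \<Rightarrow> 'a rel \<Rightarrow> nat \<Rightarrow> 'a set" where
  "level T R 0 = T - Range (successor_rel R)"
| "level T R (Suc n) = successor_rel R `` level T R n"

lemma level_exists:
  assumes "tree T R" "t \<in> T"
  shows "\<exists>n. t \<in> level T R n"
  using wf_successor_rel[OF assms(1)] assms(2)
proof (induction t)
  case (less t)
  show ?case
  proof (cases "t \<in> Range (successor_rel R)")
    case True
    then obtain u where "(u, t) \<in> successor_rel R"
      by blast
    moreover from this have "u \<in> T"
      using immediate_successors_in_tree[OF assms(1)] by simp
    ultimately obtain n where "u \<in> level T R n"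
      using less by blast
    with \<open>(u, t) \<in> successor_rel R\<close> have "t \<in> level T R (Suc n)"
      by auto
    then show ?thesis ..
  next
    case False
    with less have "t \<in> level T R 0"
      by simp
    then show ?thesis ..
  qed
qed

lemma level_subset:
  assumes "tree T R"
  shows "level T R n \<subseteq> T"
  by (induction n) (auto dest: immediate_successors_in_tree[OF assms])

text \<open>Walking down from \<open>t\<close> along immediate predecessors leaves no choice, so the
  number of steps until a node without immediate predecessor is determined by
  \<open>t\<close>.\<close>

lemma level_unique:
  assumes "tree T R" "t \<in> level T R m" "t \<in> level T R n"
  shows "m = n"
  using assms(2,3)
proof (induction m arbitrary: n t)
  case 0
  then show ?case
    by (cases n) auto
next
  case (Suc m)
  then obtain n' where n: "n = Suc n'"
    by (cases n) auto
  with Suc.prems obtain u u' where u: "u \<in> level T R m" "u' \<in> level T R n'"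
    "t \<in> immediate_successors R u" "t \<in> immediate_successors R u'"
    by auto
  then have "u = u'"
    using immediate_predecessor_unique[OF assms(1)] by blast
  with Suc.IH u n show ?case
    by blast
qed

text \<open>Members of a proper filter are nonempty, so from any point of \<open>V\<close> one can
  climb one more level without leaving \<open>V\<close>.\<close>

lemma open_meets_level:
  assumes "filtration T R F" "openin (filtration_space T R F) V" "t \<in> V" "t \<in> level T R n"
  shows "V \<inter> level T R (n + k) \<noteq> {}"
proof (induction k)
  case 0
  then show ?case
    using assms by auto
next
  case (Suc k)
  then obtain u where u: "u \<in> V" "u \<in> level T R (n + k)"
    by auto
  with assms(2) have ev: "eventually (\<lambda>s. s \<in> V \<inter> immediate_successors R u) (F u)" "u \<in> T"
    by (auto simp: openin_filtration_space)
  then have "F u \<noteq> bot"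
    using assms(1) by (auto simp: filtration_def filter_on_def)
  then obtain s where "s \<in> V" "s \<in> immediate_successors R u"
    using eventually_happens[OF ev(1)] by auto
  with u have "s \<in> V \<inter> level T R (n + Suc k)"
    by auto
  then show ?case
    by blast
qed

lemma filtration_space_resolvable:
  assumes tree: "tree T R" and filt: "filtration T R F"
  shows "resolvable natLeq (filtration_space T R F)"
proof -
  define X where "X = filtration_space T R F"
  \<comment> \<open>The pairing function splits the levels into infinitely many infinite classes,
    one for each first coordinate \<open>i\<close>.\<close>
  define D where "D i = (\<Union>j. level T R (prod_encode (i, j)))" for i
  have top: "topspace X = T"
    unfolding X_def using tree filt by (intro topspace_filtration_space) (auto simp: tree_def)
  have dense: "dense_subset X (D i)" for i
    unfolding dense_subset_def dense_intersects_open
  proof (intro conjI allI impI)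
    show "D i \<subseteq> topspace X"
      using level_subset[OF tree] by (auto simp: top D_def)
    fix V assume V: "openin X V \<and> V \<noteq> {}"
    then obtain t where t: "t \<in> V"
      by auto
    then have "t \<in> T"
      using V openin_subset top by blast
    then obtain n where n: "t \<in> level T R n"
      using level_exists[OF tree] by blast
    \<comment> \<open>Taking \<open>n\<close> itself as second coordinate gives a level of class
      \<open>i\<close> that is not below level \<open>n\<close>, because
      \<open>prod_encode (i, n)\<close> is at least \<open>n\<close>; the truncated subtraction is
      therefore exact.\<close>
    have "n + (prod_encode (i, n) - n) = prod_encode (i, n)"
      using le_prod_encode_2[of n i] by simp
    then have "V \<inter> level T R (prod_encode (i, n)) \<noteq> {}"
      using open_meets_level[OF filt _ t n, of "prod_encode (i, n) - n"] V by (simp add: X_def)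
    then show "D i \<inter> V \<noteq> {}"
      by (auto simp: D_def)
  qed
  have disj: "disjnt (D i) (D j)" if "i \<noteq> j" for i j
    using that level_unique[OF tree] by (fastforce simp: disjnt_def D_def)
  have ne: "D i \<noteq> {}" for i
    using dense[of i] tree top by (auto simp: dense_subset_def tree_def)
  have "inj D"
    using disj ne by (intro injI) (metis disjnt_self_iff_empty)
  then have "bij_betw D UNIV (range D)"
    by (simp add: bij_betw_def)
  then have "|range D| =o natLeq"
    using card_of_ordIso card_of_nat ordIso_symmetric ordIso_transitive by metis
  moreover have "pairwise disjnt (range D)"
    unfolding pairwise_def by (metis disj imageE)
  ultimately show ?thesis
    using dense unfolding resolvable_def X_def by blast
qed

section \<open>Iterated limits along the filters and hereditary irresolvability\<close>

text \<open>The layers are not cumulative: each is computed from the preceding one alone. This is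
  what lets disjointness pass from layer to layer.\<close>

primrec limit_layer :: "'a set \<Rightarrow> ('a \<Rightarrow> 'a filter) \<Rightarrow> 'a set \<Rightarrow> nat \<Rightarrow> 'a set" where
  "limit_layer T F D 0 = D"
| "limit_layer T F D (Suc n) = {t \<in> T. eventually (\<lambda>s. s \<in> limit_layer T F D n) (F t)}"

text \<open>At a common point \<open>t\<close> of the next layers, two disjoint sets would both
  belong to the proper filter \<open>F t\<close>.\<close>

lemma limit_layer_disjnt:
  assumes "filtration T R F" "disjnt D E"
  shows "disjnt (limit_layer T F D n) (limit_layer T F E n)"
proof (induction n)
  case (Suc n)
  have False if t: "t \<in> limit_layer T F D (Suc n)" "t \<in> limit_layer T F E (Suc n)" for t
  proof -
    have "eventually (\<lambda>s. s \<in> limit_layer T F D n \<and> s \<in> limit_layer T F E n) (F t)"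
      using t by (auto intro: eventually_conj)
    then have "eventually (\<lambda>s. False) (F t)"
      by eventually_elim (use Suc in \<open>auto simp: disjnt_iff\<close>)
    then show False
      using t assms(1) by (auto simp: filtration_def filter_on_def trivial_limit_def)
  qed
  then show ?case
    unfolding disjnt_iff by blast
qed (use assms in simp)

text \<open>The dichotomy in \<open>ultrafilter_on\<close> speaks of subsets of \<open>S\<close>
  only; for an arbitrary \<open>A\<close> it is applied to the trace of \<open>A\<close> on
  \<open>S\<close>.\<close>

lemma ultrafilter_on_eventually_not:
  assumes "ultrafilter_on S \<F>" "\<not> eventually (\<lambda>s. s \<in> A) \<F>"
  shows "eventually (\<lambda>s. s \<in> S - A) \<F>"
proof -
  have "eventually (\<lambda>s. s \<in> A \<inter> S) \<F> \<Longrightarrow> eventually (\<lambda>s. s \<in> A) \<F>"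
    by (erule eventually_mono) auto
  moreover have "eventually (\<lambda>s. s \<in> A \<inter> S) \<F> \<or> eventually (\<lambda>s. s \<in> S - (A \<inter> S)) \<F>"
    using assms(1) inf_le2[of A S] unfolding ultrafilter_on_def by blast
  moreover have "S - (A \<inter> S) = S - A"
    by auto
  ultimately show ?thesis
    using assms(2) by auto
qed

text \<open>A point \<open>t\<close> outside all layers is in particular outside layer
  \<open>Suc n\<close>, so the ultrafilter \<open>F t\<close> contains the complement of layer
  \<open>n\<close>. Countable completeness intersects these complements over all
  \<open>n\<close>.\<close>

lemma openin_Diff_limit_layers:
  assumes po: "partial_order_on T R" and ultra: "ultrafiltration T R F"
    and cc: "\<And>t. t \<in> T \<Longrightarrow> countably_complete (F t)"
  shows "openin (filtration_space T R F) (T - (\<Union>n. limit_layer T F D n))"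
  unfolding openin_filtration_space
proof (intro conjI ballI)
  fix t assume t: "t \<in> T - (\<Union>n. limit_layer T F D n)"
  define A where "A n = immediate_successors R t - limit_layer T F D n" for n
  have "eventually (\<lambda>s. s \<in> A n) (F t)" for n
  proof -
    have "t \<notin> limit_layer T F D (Suc n)"
      using t by blast
    with t have "\<not> eventually (\<lambda>s. s \<in> limit_layer T F D n) (F t)"
      by simp
    then show ?thesis
      unfolding A_def using t ultra
      by (intro ultrafilter_on_eventually_not) (auto simp: ultrafiltration_def)
  qed
  then have "eventually (\<lambda>s. s \<in> (\<Inter>n. A n)) (F t)"
    using cc[of t] t by (simp add: countably_complete_def)
  then show "eventually (\<lambda>s. s \<in> (T - (\<Union>n. limit_layer T F D n)) \<inter> immediate_successors R t) (F t)"
  proof eventually_elim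
    case (elim s)
    then have s: "s \<in> immediate_successors R t"
      by (auto simp: A_def)
    with successor_relD[OF this] partial_order_onD(4)[OF po] elim show ?case
      by (auto simp: A_def)
  qed
qed auto

lemma filtration_space_hereditarily_irresolvable:
  assumes po: "partial_order_on T R" and ultra: "ultrafiltration T R F"
    and cc: "\<And>t. t \<in> T \<Longrightarrow> countably_complete (F t)"
  shows "hereditarily_irresolvable omega1 (filtration_space T R F)"
  unfolding hereditarily_irresolvable_def
proof (intro allI impI notI)
  define X where "X = filtration_space T R F"
  have filt: "filtration T R F"
    using ultra by (simp add: ultrafiltration_def)
  have top: "topspace X = T"
    unfolding X_def by (rule topspace_filtration_space[OF po filt])
  fix Y assume "Y \<subseteq> topspace (filtration_space T R F) \<and> Y \<noteq> {}"
  then obtain t where Y: "Y \<subseteq> T" "t \<in> Y"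
    using top X_def by auto
  assume "resolvable omega1 (subtopology (filtration_space T R F) Y)"
  then obtain \<D> where card: "|\<D>| =o omega1" and disj: "pairwise disjnt \<D>"
    and dense: "\<And>D. D \<in> \<D> \<Longrightarrow> dense_subset (subtopology X Y) D"
    by (auto simp: resolvable_def X_def)
  \<comment> \<open>Otherwise the complement of all layers is an open neighbourhood of
    \<open>t\<close>. It misses \<open>D\<close>, which is layer 0, although \<open>D\<close> is
    dense in the subspace containing \<open>t\<close>.\<close>
  have "\<exists>n. t \<in> limit_layer T F D n" if "D \<in> \<D>" for D
  proof (rule ccontr)
    let ?V = "T - (\<Union>n. limit_layer T F D n)"
    assume "\<nexists>n. t \<in> limit_layer T F D n"
    then have "t \<in> ?V \<inter> Y"
      using Y by blast
    moreover have "openin (subtopology X Y) (?V \<inter> Y)"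
      unfolding X_def
      by (intro openin_subtopology_Int openin_Diff_limit_layers po ultra cc)
    ultimately have "D \<inter> (?V \<inter> Y) \<noteq> {}"
      using dense[OF that] unfolding dense_subset_def dense_intersects_open by blast
    then show False
      using limit_layer.simps(1)[of T F D] by blast
  qed
  then obtain n where n: "\<And>D. D \<in> \<D> \<Longrightarrow> t \<in> limit_layer T F D (n D)"
    by metis
  \<comment> \<open>Two members with the same index would have disjoint layers of that index, yet
    both layers contain \<open>t\<close>.\<close>
  have "inj_on n \<D>"
  proof (rule inj_onI, rule ccontr)
    fix D E assume DE: "D \<in> \<D>" "E \<in> \<D>" "n D = n E" "D \<noteq> E"
    then have "disjnt D E"
      using disj by (auto simp: pairwise_def)
    from limit_layer_disjnt[OF filt this, of "n D"] show False
      using n[OF DE(1)] n[OF DE(2)] DE(3) by (auto simp: disjnt_iff)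
  qed
  then have "|\<D>| \<le>o natLeq"
    by (meson card_of_nat card_of_ordLeqI ordLeq_ordIso_trans UNIV_I)
  also have "natLeq <o omega1"
    by (rule cardSuc_greater[OF natLeq_Card_order])
  finally show False
    using card not_ordLess_ordIso by blast
qed

section \<open>Monotone normality\<close>

text \<open>Predecessors being unique, two nontrivial paths with the same end have the same last
  edge. Cancelling common last edges until one path is trivial puts its starting point on the other
  path, and what remains of that path stays in its own set \<open>U\<close> or
  \<open>V\<close>.\<close>

lemma forest_confluent:
  assumes uniq: "\<And>s t t'. (t, s) \<in> E \<Longrightarrow> (t', s) \<in> E \<Longrightarrow> t = t'"
    and "(x, z) \<in> (Restr E U)\<^sup>*" "(y, z) \<in> (Restr E V)\<^sup>*"
  shows "(x, y) \<in> (Restr E U)\<^sup>* \<or> (y, x) \<in> (Restr E V)\<^sup>*"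
  using assms(2,3)
proof (induction z rule: rtrancl_induct)
  case base
  then show ?case
    by blast
next
  case (step u z)
  from step.prems show ?case
  proof (cases rule: rtranclE)
    case base
    with step.hyps show ?thesis
      by (metis rtrancl.rtrancl_into_rtrancl)
  next
    case (step u')
    with \<open>(u, z) \<in> Restr E U\<close> have "u' = u"
      using uniq by blast
    with step step.IH show ?thesis
      by blast
  qed
qed

lemma rtrancl_Restr_in:
  assumes "(x, y) \<in> (Restr E U)\<^sup>*" "x \<in> U"
  shows "y \<in> U"
  using assms by (induction rule: rtrancl_induct) auto

text \<open>Removing one point from the tree removes at most one immediate successor of each node,
  and \<open>F t\<close> contains the cofinite sets.\<close>

lemma filtration_space_t1:
  assumes tree: "tree T R" and filt: "filtration T R F"
  shows "t1_space (filtration_space T R F)"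
proof -
  have top: "topspace (filtration_space T R F) = T"
    using tree filt by (intro topspace_filtration_space) (auto simp: tree_def)
  have "openin (filtration_space T R F) (T - {x})" for x
    unfolding openin_filtration_space
  proof (intro conjI ballI)
    fix t assume "t \<in> T - {x}"
    let ?S = "immediate_successors R t"
    have "finite (?S - (?S - {x}))"
      by (rule finite_subset[of _ "{x}"]) auto
    with filt \<open>t \<in> T - {x}\<close> have "eventually (\<lambda>s. s \<in> ?S - {x}) (F t)"
      unfolding filtration_def by blast
    then show "eventually (\<lambda>s. s \<in> (T - {x}) \<inter> ?S) (F t)"
      by eventually_elim (auto dest: immediate_successors_in_tree[OF tree])
  qed auto
  then show ?thesis
    by (auto simp: t1_space_closedin_singleton closedin_def top)
qed

text \<open>\<open>H x U\<close> is open because the successors in \<open>U\<close> of a point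
  reached from \<open>x\<close> are one step further on. If \<open>H x U\<close> and
  \<open>H y V\<close> meet, confluence gives a path from \<open>x\<close> to \<open>y\<close>
  inside \<open>U\<close> or from \<open>y\<close> to \<open>x\<close> inside \<open>V\<close>, so
  one starting point lies in the other open set.\<close>

lemma filtration_space_monotonically_normal:
  assumes tree: "tree T R" and filt: "filtration T R F"
  shows "monotonically_normal (filtration_space T R F)"
proof -
  let ?X = "filtration_space T R F"
  define H where "H x U = {y. (x, y) \<in> (Restr (successor_rel R) U)\<^sup>*}" for x U
  have sub: "H x U \<subseteq> U" if "x \<in> U" for x U
    using that by (auto simp: H_def dest: rtrancl_Restr_in)
  have "openin ?X (H x U)" if "openin ?X U" "x \<in> U" for x U
    unfolding openin_filtration_space
  proof (intro conjI ballI)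
    show "H x U \<subseteq> T"
      using sub[of x U] that by (auto simp: openin_filtration_space)
    fix y assume y: "y \<in> H x U"
    then have "y \<in> U"
      using sub that by blast
    then have "eventually (\<lambda>s. s \<in> U \<inter> immediate_successors R y) (F y)"
      using that by (auto simp: openin_filtration_space)
    then show "eventually (\<lambda>s. s \<in> H x U \<inter> immediate_successors R y) (F y)"
    proof eventually_elim
      case (elim s)
      then have "(y, s) \<in> Restr (successor_rel R) U"
        using \<open>y \<in> U\<close> by simp
      with y have "s \<in> H x U"
        unfolding H_def by (metis mem_Collect_eq rtrancl.rtrancl_into_rtrancl)
      with elim show ?case
        by blast
    qed
  qed
  moreover have "x \<in> V \<or> y \<in> U" if mem: "x \<in> U" "y \<in> V" and meet: "H x U \<inter> H y V \<noteq> {}" for x U y V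
  proof -
    obtain z where "(x, z) \<in> (Restr (successor_rel R) U)\<^sup>*" "(y, z) \<in> (Restr (successor_rel R) V)\<^sup>*"
      using meet by (auto simp: H_def)
    then have "(x, y) \<in> (Restr (successor_rel R) U)\<^sup>* \<or> (y, x) \<in> (Restr (successor_rel R) V)\<^sup>*"
      by (intro forest_confluent) (auto dest: immediate_predecessor_unique[OF tree])
    then show ?thesis
      using mem rtrancl_Restr_in by metis
  qed
  moreover have "x \<in> H x U" for x U
    by (simp add: H_def)
  ultimately show ?thesis
    unfolding monotonically_normal_def
    using filtration_space_t1[OF assms] sub
    by (intro conjI exI[of _ H] allI impI) (simp, simp, simp, simp, metis)
qed

section \<open>The tree of finite sequences in an infinite set\<close>

text \<open>By induction on the length, the lists of a fixed length number at most
  \<open>|A|\<close>, since a product of two sets of size at most \<open>|A|\<close> has size at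
  most \<open>|A|\<close>. There are only countably many lengths.\<close>

lemma card_of_lists_ordIso:
  assumes "infinite A"
  shows "|lists A| =o |A|"
proof -
  define L where "L n = {xs \<in> lists A. length xs = n}" for n
  have "|L n| \<le>o |A|" for n
  proof (induction n)
    case 0
    have "L 0 = {[]}"
      by (auto simp: L_def)
    then show ?case
      using assms by (metis card_of_singl_ordLeq finite.emptyI)
  next
    case (Suc n)
    have "L (Suc n) \<subseteq> case_prod (#) ` (A \<times> L n)"
      by (auto simp: L_def length_Suc_conv image_iff)
    then have "|L (Suc n)| \<le>o |A \<times> L n|"
      by (rule surj_imp_ordLeq)
    also have "|A \<times> L n| \<le>o |A|"
      using assms Suc by (intro card_of_Sigma_ordLeq_infinite) (auto intro: card_of_mono1)
    finally show ?case .
  qed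
  moreover have "|UNIV :: nat set| \<le>o |A|"
    using assms infinite_iff_card_of_nat by blast
  ultimately have "|\<Union>n. L n| \<le>o |A|"
    using assms by (intro card_of_UNION_ordLeq_infinite) simp_all
  moreover have "(\<Union>n. L n) = lists A"
    by (auto simp: L_def)
  moreover have "|A| \<le>o |lists A|"
    by (rule card_of_ordLeqI[of "\<lambda>x. [x]"]) (auto simp: inj_on_def)
  ultimately show ?thesis
    by (simp add: ordIso_iff_ordLeq)
qed

lemma finite_well_order_on:
  assumes "linear_order_on A r" "finite A"
  shows "well_order_on A r"
proof -
  have "r \<subseteq> A \<times> A"
    using assms(1) by (auto simp: linear_order_on_def dest: partial_order_onD(4))
  then have "finite r"
    using assms(2) by (meson finite_SigmaI finite_subset)
  then show ?thesis
    using linear_order_on_well_order_on assms(1) by blast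
qed

text \<open>
  The tree of finite sequences in \<open>K\<close>, its nodes being named by elements of \<open>K\<close> via the
  bijection \<open>g\<close>.
\<close>

locale sequence_tree =
  fixes K :: "'a set" and g :: "'a \<Rightarrow> 'a list"
  assumes bij: "bij_betw g K (lists K)"
begin

definition R :: "'a rel" where
  "R = {(s, t). s \<in> K \<and> t \<in> K \<and> prefix (g s) (g t)}"

definition child :: "'a \<Rightarrow> 'a \<Rightarrow> 'a" where
  "child t x = inv_into K g (g t @ [x])"

lemma g_eq_iff: "s \<in> K \<Longrightarrow> t \<in> K \<Longrightarrow> g s = g t \<longleftrightarrow> s = t"
  using bij by (auto simp: bij_betw_def inj_on_def)

lemma g_lists: "t \<in> K \<Longrightarrow> g t \<in> lists K"
  using bij by (auto simp: bij_betw_def)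

lemma g_surj: "xs \<in> lists K \<Longrightarrow> \<exists>t\<in>K. g t = xs"
  using bij by (metis bij_betw_def imageE)

lemma child:
  assumes "t \<in> K" "x \<in> K"
  shows "child t x \<in> K" "g (child t x) = g t @ [x]"
proof -
  have "g t @ [x] \<in> g ` K"
    using assms g_lists[of t] bij by (simp add: bij_betw_def)
  then show "child t x \<in> K" "g (child t x) = g t @ [x]"
    unfolding child_def by (auto intro: inv_into_into f_inv_into_f)
qed

lemma inj_on_child: "t \<in> K \<Longrightarrow> inj_on (child t) K"
  by (rule inj_onI) (metis child(2) append1_eq_conv)

lemma underS_R: "t \<in> K \<Longrightarrow> underS R t = {s \<in> K. strict_prefix (g s) (g t)}"
  by (auto simp: underS_def R_def strict_prefix_def g_eq_iff)

lemma immediate_successors_R: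
  assumes "t \<in> K"
  shows "immediate_successors R t = child t ` K"
proof (intro equalityI subsetI)
  fix s assume "s \<in> immediate_successors R t"
  then have ts: "t \<in> underS R s" and min: "\<And>u. t \<in> underS R u \<Longrightarrow> u \<notin> underS R s"
    by (auto simp: immediate_successors_def)
  have s: "s \<in> K"
    using ts by (auto simp: underS_def R_def)
  with ts have "strict_prefix (g t) (g s)"
    by (simp add: underS_R)
  \<comment> \<open>Here \<open>x\<close> is the first entry of \<open>s\<close> beyond
    \<open>t\<close>. The node \<open>child t x\<close> lies weakly between \<open>t\<close> and
    \<open>s\<close>, so minimality forces it to be \<open>s\<close>.\<close>
  then obtain x xs where gs: "g s = g t @ x # xs"
    by (elim strict_prefixE')
  with g_lists[OF s] have x: "x \<in> K"
    by simp
  have "t \<in> underS R (child t x)"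
    using assms x by (simp add: underS_R child strict_prefix_def)
  then have "child t x \<notin> underS R s"
    by (rule min)
  moreover have "prefix (g (child t x)) (g s)"
    using assms x gs by (simp add: child)
  ultimately have "child t x = s"
    using s child(1)[OF assms x] by (auto simp: underS_def R_def)
  with x show "s \<in> child t ` K"
    by blast
next
  fix s assume "s \<in> child t ` K"
  then obtain x where x: "x \<in> K" and s: "s = child t x"
    by blast
  have "s \<in> K" "g s = g t @ [x]"
    using child[OF assms x] s by auto
  then have "t \<in> underS R s"
    using assms by (simp add: underS_R strict_prefix_def)
  moreover have False if "t \<in> underS R u" "u \<in> underS R s" for u
  proof -
    have "u \<in> K"
      using that(2) by (auto simp: underS_def R_def)
    then have "strict_prefix (g t) (g u)" "strict_prefix (g u) (g t @ [x])"
      using that \<open>s \<in> K\<close> \<open>g s = g t @ [x]\<close> by (simp_all add: underS_R)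
    \<comment> \<open>An intermediate node would need a length strictly between two consecutive
      numbers.\<close>
    then have "length (g t) < length (g u)" "length (g u) < Suc (length (g t))"
      using prefix_length_less by fastforce+
    then show False
      by simp
  qed
  ultimately show "s \<in> immediate_successors R t"
    by (auto simp: immediate_successors_def)
qed

lemma partial_order_R: "partial_order_on K R"
  unfolding partial_order_on_def preorder_on_def
proof (intro conjI)
  show "trans R"
    by (rule transI) (auto simp: R_def intro: prefix_order.trans)
  show "antisym R"
    by (rule antisymI) (auto simp: R_def g_eq_iff dest: prefix_order.antisym)
qed (auto simp: R_def refl_on_def)

text \<open>A finite sequence has finitely many prefixes, any two of them comparable; a finite
  linear order is a well-order.\<close>

lemma tree_R:
  assumes "K \<noteq> {}"
  shows "tree K R"
  unfolding tree_def
proof (intro conjI ballI assms partial_order_R)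
  fix t assume t: "t \<in> K"
  let ?A = "underS R t"
  have "inj_on g ?A" "g ` ?A \<subseteq> set (prefixes (g t))"
    using t by (auto simp: underS_R inj_on_def g_eq_iff)
  then have "finite ?A"
    by (meson finite_imageD finite_set finite_subset)
  moreover have "linear_order_on ?A (Restr R ?A)"
    unfolding linear_order_on_def partial_order_on_def preorder_on_def
  proof (intro conjI)
    show "refl_on ?A (Restr R ?A)"
      by (auto simp: refl_on_def R_def underS_def)
    show "trans (Restr R ?A)" "antisym (Restr R ?A)"
      using partial_order_onD(2,3)[OF partial_order_R]
      by (auto intro: trans_Restr antisym_subset)
    show "total_on ?A (Restr R ?A)"
      by (auto simp: total_on_def R_def underS_def dest: prefix_same_cases)
  qed auto
  ultimately show "well_order_on ?A (Restr R ?A)"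
    by (intro finite_well_order_on)
qed

definition copy_filter :: "'a filter \<Rightarrow> 'a \<Rightarrow> 'a filter" where
  "copy_filter \<U> t = filtermap (child t) \<U>"

text \<open>A set of successors of \<open>t\<close> is measured by its preimage under
  \<open>child t\<close>, so the dichotomy for \<open>\<U>\<close> carries over.\<close>

lemma ultrafilter_on_copy_filter:
  assumes "ultrafilter_on K \<U>" "t \<in> K"
  shows "ultrafilter_on (immediate_successors R t) (copy_filter \<U> t)"
  unfolding ultrafilter_on_def filter_on_def
proof (intro conjI allI impI)
  have K: "eventually (\<lambda>x. x \<in> K) \<U>" and ne: "\<U> \<noteq> bot"
    using assms(1) by (auto simp: ultrafilter_on_def filter_on_def le_principal)
  show "copy_filter \<U> t \<le> principal (immediate_successors R t)"
    unfolding le_principal copy_filter_def eventually_filtermap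
    using K by eventually_elim (simp add: immediate_successors_R assms)
  show "copy_filter \<U> t \<noteq> bot"
    using ne by (simp add: copy_filter_def filtermap_bot_iff)
  fix A assume "A \<subseteq> immediate_successors R t"
  show "eventually (\<lambda>x. x \<in> A) (copy_filter \<U> t) \<or>
        eventually (\<lambda>x. x \<in> immediate_successors R t - A) (copy_filter \<U> t)"
  proof (cases "eventually (\<lambda>x. x \<in> child t -` A) \<U>")
    case True
    then show ?thesis
      by (simp add: copy_filter_def eventually_filtermap)
  next
    case False
    from ultrafilter_on_eventually_not[OF assms(1) this]
    have "eventually (\<lambda>x. child t x \<in> immediate_successors R t - A) \<U>"
      by eventually_elim (simp add: immediate_successors_R assms)
    then show ?thesis
      by (simp add: copy_filter_def eventually_filtermap)
  qed
qed

end

section \<open>Complete ultrafilters and the space of a measurable cardinal\<close>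

lemma countably_complete_filtermap:
  assumes "countably_complete \<F>"
  shows "countably_complete (filtermap f \<F>)"
  unfolding countably_complete_def
proof (intro allI impI)
  fix A :: "nat \<Rightarrow> 'b set"
  assume "\<forall>n. eventually (\<lambda>x. x \<in> A n) (filtermap f \<F>)"
  then have "eventually (\<lambda>x. x \<in> f -` A n) \<F>" for n
    by (simp add: eventually_filtermap)
  then have "eventually (\<lambda>x. x \<in> (\<Inter>n. f -` A n)) \<F>"
    by (rule assms[unfolded countably_complete_def, rule_format])
  then show "eventually (\<lambda>x. x \<in> (\<Inter>n. A n)) (filtermap f \<F>)"
    by (simp add: eventually_filtermap)
qed

lemma complete_filter_imp_countably_complete:
  assumes "complete_filter \<kappa> \<F>" "natLeq <o \<kappa>"
  shows "countably_complete \<F>"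
  unfolding countably_complete_def
proof (intro allI impI)
  fix A :: "nat \<Rightarrow> 'b set"
  assume "\<forall>n. eventually (\<lambda>x. x \<in> A n) \<F>"
  moreover have "|range A| <o \<kappa>"
    using card_of_image[of A UNIV] card_of_nat assms(2)
      ordLeq_ordIso_trans ordLeq_ordLess_trans by metis
  ultimately show "eventually (\<lambda>x. x \<in> (\<Inter>n. A n)) \<F>"
    using assms(1) unfolding complete_filter_def by auto
qed

text \<open>The complement of each singleton is in the ultrafilter, and fewer than \<kappa> of these
  complements may be intersected.\<close>

lemma complete_nonprincipal_small:
  assumes ultra: "ultrafilter_on K \<U>" and compl: "complete_filter \<kappa> \<U>"
    and np: "\<And>a. a \<in> K \<Longrightarrow> \<not> eventually (\<lambda>x. x \<in> {a}) \<U>"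
    and small: "|A| <o \<kappa>"
  shows "eventually (\<lambda>x. x \<notin> A) \<U>"
proof -
  have "eventually (\<lambda>x. x \<in> - {a}) \<U>" for a
  proof (cases "a \<in> K")
    case True
    from ultrafilter_on_eventually_not[OF ultra np[OF True]] show ?thesis
      by eventually_elim simp
  next
    case False
    have "eventually (\<lambda>x. x \<in> K) \<U>"
      using ultra by (simp add: ultrafilter_on_def filter_on_def le_principal)
    then show ?thesis
      by eventually_elim (use False in auto)
  qed
  moreover have "|(\<lambda>a. - {a}) ` A| <o \<kappa>"
    using card_of_image small ordLeq_ordLess_trans by blast
  ultimately have "eventually (\<lambda>x. x \<in> \<Inter>((\<lambda>a. - {a}) ` A)) \<U>"
    using compl unfolding complete_filter_def by blast
  then show ?thesis
    by eventually_elim auto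
qed

text \<open>The definition picks its value by \<open>SOME\<close>. As all nonempty open sets are
  equipotent, the whole space witnesses that a minimum exists, and whatever is picked is the
  cardinality of some nonempty open set.\<close>

lemma dispersion_character_ordIso:
  fixes \<kappa> :: "'k rel"
  assumes "topspace X \<noteq> {}" "\<And>G. openin X G \<Longrightarrow> G \<noteq> {} \<Longrightarrow> |G| =o \<kappa>"
  shows "dispersion_character X =o \<kappa>"
proof -
  let ?P = "\<lambda>r. \<exists>G. openin X G \<and> G \<noteq> {} \<and> r = |G| \<and>
                  (\<forall>G'. openin X G' \<and> G' \<noteq> {} \<longrightarrow> |G| \<le>o |G'| )"
  have "|topspace X| \<le>o |G|" if "openin X G" "G \<noteq> {}" for G
    by (rule ordIso_imp_ordLeq, rule ordIso_transitive[OF _ ordIso_symmetric])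
      (use assms that in auto)
  then have "?P |topspace X|"
    using assms(1) by blast
  then have "?P (dispersion_character X)"
    unfolding dispersion_character_def by (rule someI)
  with assms(2) show ?thesis
    by metis
qed

lemma measurable_cardinal_space:
  fixes \<kappa> :: "'k rel"
  assumes "measurable_cardinal \<kappa>"
  shows "\<exists>X :: 'k topology. monotonically_normal X \<and>
           |topspace X| =o \<kappa> \<and> dispersion_character X =o \<kappa> \<and>
           hereditarily_irresolvable omega1 X"
proof -
  define K where "K = Field \<kappa>"
  obtain \<U> where co: "Card_order \<kappa>" and unc: "natLeq <o \<kappa>"
    and ultra: "ultrafilter_on K \<U>" and compl: "complete_filter \<kappa> \<U>"
    and np: "\<And>a. a \<in> K \<Longrightarrow> \<not> eventually (\<lambda>x. x \<in> {a}) \<U>"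
    using assms by (auto simp: measurable_cardinal_def K_def)
  have K: "|K| =o \<kappa>"
    unfolding K_def by (rule card_of_Field_ordIso[OF co])
  have "natLeq \<le>o |K|"
    using unc K ordIso_symmetric ordLess_imp_ordLeq ordLeq_ordIso_trans by blast
  then have inf: "infinite K"
    using infinite_iff_natLeq_ordLeq by blast
  \<comment> \<open>Naming the sequences by elements of \<open>K\<close> makes the points of the
    space elements of the field of \<kappa>, so that the space lives on the type
    \<open>'k\<close>.\<close>
  obtain g where "bij_betw g K (lists K)"
    using card_of_lists_ordIso[OF inf] card_of_ordIso ordIso_symmetric by blast
  then interpret sequence_tree K g
    by unfold_locales
  have small: "eventually (\<lambda>x. x \<notin> A) \<U>" if "|A| <o \<kappa>" for A
    using complete_nonprincipal_small[OF ultra compl np that] .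
  have tree: "tree K R"
    using inf by (intro tree_R) auto
  \<comment> \<open>Since \<open>child t\<close> is injective, a finite set of missed successors
    comes from a finite set of entries, which is negligible for \<open>\<U>\<close>.\<close>
  have fin: "eventually (\<lambda>s. s \<in> A) (copy_filter \<U> t)"
    if "t \<in> K" "finite (immediate_successors R t - A)" for t A
  proof -
    have "finite {x \<in> K. child t x \<notin> A}"
    proof (rule inj_on_finite[OF _ _ that(2)])
      show "inj_on (child t) {x \<in> K. child t x \<notin> A}"
        by (rule inj_on_subset[OF inj_on_child[OF that(1)]]) auto
    qed (auto simp: immediate_successors_R that)
    then have "|{x \<in> K. child t x \<notin> A}| <o \<kappa>"
      using unc finite_iff_ordLess_natLeq ordLess_transitive by blast
    moreover have "eventually (\<lambda>x. x \<in> K) \<U>"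
      using ultra by (simp add: ultrafilter_on_def filter_on_def le_principal)
    ultimately have "eventually (\<lambda>x. x \<notin> {x \<in> K. child t x \<notin> A} \<and> x \<in> K) \<U>"
      using small by (intro eventually_conj)
    then show ?thesis
      unfolding copy_filter_def eventually_filtermap by eventually_elim auto
  qed
  have uf: "ultrafiltration K R (copy_filter \<U>)"
    using ultrafilter_on_copy_filter[OF ultra] fin
    by (simp add: ultrafiltration_def filtration_def ultrafilter_on_def)
  then have filt: "filtration K R (copy_filter \<U>)"
    by (simp add: ultrafiltration_def)
  define X where "X = filtration_space K R (copy_filter \<U>)"
  have top: "topspace X = K"
    unfolding X_def by (rule topspace_filtration_space[OF partial_order_R filt])
  have "hereditarily_irresolvable omega1 X"
    unfolding X_def
    by (intro filtration_space_hereditarily_irresolvable partial_order_R uf)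
      (simp add: copy_filter_def countably_complete_filtermap
        complete_filter_imp_countably_complete[OF compl unc])
  moreover have "monotonically_normal X"
    unfolding X_def by (rule filtration_space_monotonically_normal[OF tree filt])
  moreover have "|G| =o \<kappa>" if G: "openin X G" "G \<noteq> {}" for G
  proof -
    obtain t where t: "t \<in> G"
      using G by auto
    have "G \<subseteq> K"
      using openin_subset[OF G(1)] top by simp
    \<comment> \<open>\<open>A\<close> collects the entries leading from \<open>t\<close> back into
      \<open>G\<close>. Openness puts it in \<open>\<U>\<close>, so it cannot be smaller than
      \<kappa>, and \<open>child t\<close> embeds it into \<open>G\<close>.\<close>
    define A where "A = {x \<in> K. child t x \<in> G}"
    have "\<not> |A| <o \<kappa>"
    proof
      assume "|A| <o \<kappa>"
      from small[OF this] have "eventually (\<lambda>x. x \<notin> A) \<U>" .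
      moreover have "eventually (\<lambda>x. child t x \<in> G) \<U>"
        using G(1) t unfolding X_def openin_filtration_space copy_filter_def eventually_filtermap
        by (auto elim: eventually_mono)
      moreover have "eventually (\<lambda>x. x \<in> K) \<U>"
        using ultra by (simp add: ultrafilter_on_def filter_on_def le_principal)
      ultimately have "eventually (\<lambda>x. False) \<U>"
        by eventually_elim (auto simp: A_def)
      with ultra show False
        by (simp add: ultrafilter_on_def filter_on_def trivial_limit_def)
    qed
    then have "\<kappa> \<le>o |A|"
      using co card_of_Well_order[of A] not_ordLess_iff_ordLeq
      by (metis card_order_on_well_order_on)
    also have "|A| \<le>o |G|"
      by (rule card_of_ordLeqI[of "child t"])
        (use inj_on_child[of t] t \<open>G \<subseteq> K\<close> in \<open>auto simp: A_def inj_on_def\<close>)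
    finally have "\<kappa> \<le>o |G|" .
    moreover have "|G| \<le>o \<kappa>"
      using card_of_mono1[OF \<open>G \<subseteq> K\<close>] K ordLeq_ordIso_trans by blast
    ultimately show ?thesis
      by (simp add: ordIso_iff_ordLeq)
  qed
  then have "dispersion_character X =o \<kappa>"
    using top inf by (intro dispersion_character_ordIso) auto
  moreover have "|topspace X| =o \<kappa>"
    using K by (simp add: top)
  ultimately show ?thesis
    by blast
qed

theorem corollary3p7:
  shows "(\<forall>(T :: 'a set) R F.
            tree T R \<and> everywhere_infinitely_branching T R \<and> ultrafiltration T R F \<and>
            (\<forall>t\<in>T. countably_complete (F t)) \<longrightarrow>
            resolvable natLeq (filtration_space T R F) \<and>
            hereditarily_irresolvable omega1 (filtration_space T R F)) \<and>
         (\<forall>\<kappa> :: 'k rel. measurable_cardinal \<kappa> \<longrightarrow>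
            (\<exists>X :: 'k topology. monotonically_normal X \<and>
               |topspace X| =o \<kappa> \<and> dispersion_character X =o \<kappa> \<and>
               hereditarily_irresolvable omega1 X))"
proof (intro conjI allI impI)
  fix T :: "'a set" and R F
  assume A: "tree T R \<and> everywhere_infinitely_branching T R \<and> ultrafiltration T R F \<and>
            (\<forall>t\<in>T. countably_complete (F t))"
  then show "resolvable natLeq (filtration_space T R F)"
    by (simp add: filtration_space_resolvable ultrafiltration_def)
  show "hereditarily_irresolvable omega1 (filtration_space T R F)"
    using A by (simp add: filtration_space_hereditarily_irresolvable tree_def)
qed (rule measurable_cardinal_space)

end
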